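(* Let $n\ge 3$, $1\le t<n$, and let $c_1,c_2,\ldots,c_t\in[n]$ be distinct integers such that the sequence $(c_1,\ldots,c_t)$ avoids both patterns $132$ and $213$. If there exist $\alpha,\beta\in[n]\setminus\{c_1,\ldots,c_t\}$ and $i\in[t]$ with $\min\{c_1,\ldots,c_t\}<\alpha<c_i<\beta$, then $|S_{n,(c_1,\ldots,c_t)}(132,213)|=0$; if there exist $\alpha\in[n]\setminus\{c_1,\ldots,c_t\}$ and $i,j\in[t]$ with $i<j$ such that $c_i<\alpha<c_j$ or $c_j<c_i<\alpha$, then $|S_{n,(c_1,\ldots,c_t)}(132,213)|=0$; otherwise (if neither condition holds), $$|S_{n,(c_1,\ldots,c_t)}(132,213)|=2^{\max\{0,\min\{c_1,\ldots,c_t\}-2\}}.$$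
   Context: $[n]=\{1,\ldots,n\}$ and $S_n$ is the set of permutations of $[n]$ written as sequences $(\tau(1),\ldots,\tau(n))$. A sequence of distinct integers $\tau=(\tau(1),\ldots,\tau(m))$ contains $\sigma\in S_k$ as a pattern if there are indices $1\le i_1<\cdots<i_k\le m$ such that for all $1\le a<b\le k$, $\tau(i_a)<\tau(i_b)$ if and only if $\sigma(a)<\sigma(b)$; otherwise $\tau$ avoids $\sigma$. $S_{n,(c_1,\ldots,c_t)}(\sigma_1,\ldots,\sigma_m)$ is the set of $\tau\in S_n$ with $(\tau(1),\ldots,\tau(t))=(c_1,\ldots,c_t)$ that avoid all of $\sigma_1,\ldots,\sigma_m$. *)

theory Defs
  imports "HOL-Combinatorics.Multiset_Permutations"
begin

text \<open>
  Sequences are lists, so positions are counted from 0. Permutations of \<open>{1..n}\<close> in one-line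
  notation are the elements of \<open>permutations_of_set {1..n}\<close>.
\<close>

text \<open>The map \<open>f\<close> lists the positions \<open>i\<^sub>1 < \<dots> < i\<^sub>k\<close> of an occurrence of \<open>\<sigma>\<close> in \<open>\<tau>\<close>.\<close>

definition contains_pattern :: "'a::linorder list \<Rightarrow> nat list \<Rightarrow> bool" where
  "contains_pattern \<tau> \<sigma> \<longleftrightarrow>
    (\<exists>f :: nat \<Rightarrow> nat. strict_mono_on {..<length \<sigma>} f \<and> f ` {..<length \<sigma>} \<subseteq> {..<length \<tau>} \<and>
      (\<forall>a b. a < b \<and> b < length \<sigma> \<longrightarrow> (\<tau> ! f a < \<tau> ! f b \<longleftrightarrow> \<sigma> ! a < \<sigma> ! b)))"

definition avoids_pattern :: "'a::linorder list \<Rightarrow> nat list \<Rightarrow> bool" where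
  "avoids_pattern \<tau> \<sigma> \<longleftrightarrow> \<not> contains_pattern \<tau> \<sigma>"

definition prefix_avoiders :: "nat \<Rightarrow> nat list \<Rightarrow> nat list set \<Rightarrow> nat list set" where
  "prefix_avoiders n cs P =
    {\<tau> \<in> permutations_of_set {1..n}. take (length cs) \<tau> = cs \<and> (\<forall>\<sigma>\<in>P. avoids_pattern \<tau> \<sigma>)}"

end

theory Submission
  imports Defs
begin

text \<open>
  Let \<open>m\<close> be the minimum of the prefix. In an avoider, the entries after \<open>m\<close> that exceed \<open>m\<close> are
  increasing (avoidance of \<open>132\<close>) and no entry below \<open>m\<close> precedes any of them (avoidance of
  \<open>213\<close>). So the part after the prefix is the increasing list of the missing values above \<open>m\<close>,
  followed by an avoider of \<open>{1..<m}\<close>. When neither condition holds, every such concatenation is an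
  avoider. For one-entry prefixes neither condition can hold, which gives the recursion
  \<open>f k = (\<Sum>j<k. f j)\<close> for the number \<open>f k\<close> of avoiders of \<open>{1..k}\<close>.
\<close>

section \<open>Conditions on all triples of a list\<close>

fun triplewise :: "('a \<Rightarrow> 'a \<Rightarrow> 'a \<Rightarrow> bool) \<Rightarrow> 'a list \<Rightarrow> bool" where
  "triplewise P [] \<longleftrightarrow> True"
| "triplewise P (x # xs) \<longleftrightarrow> sorted_wrt (P x) xs \<and> triplewise P xs"

text \<open>The conjuncts classify a triple by how many of its entries lie in \<open>xs\<close>:
  three, none, one, two.\<close>

lemma triplewise_append:
  "triplewise P (xs @ ys) \<longleftrightarrow> triplewise P xs \<and> triplewise P ys \<and>
     (\<forall>x\<in>set xs. sorted_wrt (P x) ys) \<and> sorted_wrt (\<lambda>x y. \<forall>z\<in>set ys. P x y z) xs"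
  by (induction xs) (auto simp: sorted_wrt_append)

lemma triplewise_iff_nth:
  "triplewise P xs \<longleftrightarrow>
     (\<forall>i j k. i < j \<longrightarrow> j < k \<longrightarrow> k < length xs \<longrightarrow> P (xs ! i) (xs ! j) (xs ! k))"
proof (induction xs)
  case (Cons x xs)
  have "(\<forall>i j k. i < j \<longrightarrow> j < k \<longrightarrow> k < length (x # xs) \<longrightarrow>
            P ((x # xs) ! i) ((x # xs) ! j) ((x # xs) ! k)) \<longleftrightarrow>
        (\<forall>j k. j < k \<longrightarrow> k < length xs \<longrightarrow> P x (xs ! j) (xs ! k)) \<and>
        (\<forall>i j k. i < j \<longrightarrow> j < k \<longrightarrow> k < length xs \<longrightarrow> P (xs ! i) (xs ! j) (xs ! k))"
    (is "?L \<longleftrightarrow> ?A \<and> ?B")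
  proof (intro iffI conjI)
    assume L: ?L
    show ?A
    proof (intro allI impI)
      fix j k assume "j < k" "k < length xs"
      then show "P x (xs ! j) (xs ! k)"
        using L[rule_format, of 0 "Suc j" "Suc k"] by simp
    qed
    show ?B
    proof (intro allI impI)
      fix i j k assume "i < j" "j < k" "k < length xs"
      then show "P (xs ! i) (xs ! j) (xs ! k)"
        using L[rule_format, of "Suc i" "Suc j" "Suc k"] by simp
    qed
  next
    assume AB: "?A \<and> ?B"
    show ?L
    proof (intro allI impI)
      fix i j k assume "i < j" "j < k" "k < length (x # xs)"
      \<comment> \<open>The two later positions are successors, so only \<open>i\<close> needs a
        case split: \<open>i = 0\<close> is the first part of \<open>AB\<close>, a successor the
        second.\<close>
      then obtain j' k' where "j = Suc j'" "k = Suc k'" "j' < k'" "k' < length xs" "i \<le> j'"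
        by (cases j; cases k) auto
      then show "P ((x # xs) ! i) ((x # xs) ! j) ((x # xs) ! k)"
        using AB by (cases i) auto
    qed
  qed
  then show ?case
    using Cons by (simp add: sorted_wrt_iff_nth_less)
qed simp

lemma sorted_wrtI:
  "(\<And>x y. x \<in> set xs \<Longrightarrow> y \<in> set xs \<Longrightarrow> P x y) \<Longrightarrow> sorted_wrt P xs"
  by (induction xs) auto

section \<open>Patterns of length three as a condition on triples\<close>

lemma contains_pattern_3:
  "contains_pattern \<tau> [p, q, r] \<longleftrightarrow>
     (\<exists>i j k. i < j \<and> j < k \<and> k < length \<tau> \<and> (\<tau> ! i < \<tau> ! j \<longleftrightarrow> p < q) \<and>
       (\<tau> ! i < \<tau> ! k \<longleftrightarrow> p < r) \<and> (\<tau> ! j < \<tau> ! k \<longleftrightarrow> q < r))"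
proof -
  have len: "length [p, q, r] = 3"
    by simp
  show ?thesis
  proof
    assume "contains_pattern \<tau> [p, q, r]"
    then obtain f :: "nat \<Rightarrow> nat" where f: "strict_mono_on {..<3} f" "f ` {..<3} \<subseteq> {..<length \<tau>}"
      and eq: "\<forall>a b. a < b \<and> b < 3 \<longrightarrow>
        (\<tau> ! f a < \<tau> ! f b \<longleftrightarrow> [p, q, r] ! a < [p, q, r] ! b)"
      unfolding contains_pattern_def len by blast
    have "f 0 < f 1" "f 1 < f 2"
      by (rule strict_mono_onD[OF f(1)]; simp)+
    moreover have "f 2 < length \<tau>"
      using f(2) by (simp add: image_subset_iff)
    ultimately show "\<exists>i j k. i < j \<and> j < k \<and> k < length \<tau> \<and> (\<tau> ! i < \<tau> ! j \<longleftrightarrow> p < q) \<and>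
         (\<tau> ! i < \<tau> ! k \<longleftrightarrow> p < r) \<and> (\<tau> ! j < \<tau> ! k \<longleftrightarrow> q < r)"
      using eq[rule_format, of 0 1] eq[rule_format, of 0 2] eq[rule_format, of 1 2]
      by (intro exI[of _ "f 0"] exI[of _ "f 1"] exI[of _ "f 2"]) simp
  next
    assume "\<exists>i j k. i < j \<and> j < k \<and> k < length \<tau> \<and> (\<tau> ! i < \<tau> ! j \<longleftrightarrow> p < q) \<and>
         (\<tau> ! i < \<tau> ! k \<longleftrightarrow> p < r) \<and> (\<tau> ! j < \<tau> ! k \<longleftrightarrow> q < r)"
    then obtain i j k where ijk: "i < j" "j < k" "k < length \<tau>" "\<tau> ! i < \<tau> ! j \<longleftrightarrow> p < q"
         "\<tau> ! i < \<tau> ! k \<longleftrightarrow> p < r" "\<tau> ! j < \<tau> ! k \<longleftrightarrow> q < r"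
      by blast
    have less_3: "a < b \<and> b < 3 \<longleftrightarrow> a = 0 \<and> b = 1 \<or> a = 0 \<and> b = 2 \<or> a = 1 \<and> b = 2"
      for a b :: nat
      by auto
    have set_3: "{..<3} = {0, 1, 2 :: nat}"
      by auto
    \<comment> \<open>The witness for the position map is indexing into the list of the three
      positions.\<close>
    have "strict_mono_on {..<3} ((!) [i, j, k])"
      using ijk(1,2) unfolding strict_mono_on_def set_3 by auto
    moreover have "(!) [i, j, k] ` {..<3} \<subseteq> {..<length \<tau>}"
      using ijk(1-3) unfolding set_3 by simp
    moreover have "\<forall>a b. a < b \<and> b < 3 \<longrightarrow>
        (\<tau> ! ([i, j, k] ! a) < \<tau> ! ([i, j, k] ! b) \<longleftrightarrow> [p, q, r] ! a < [p, q, r] ! b)"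
      unfolding less_3 using ijk(4-6) by (intro allI impI) (elim disjE; simp)
    ultimately show "contains_pattern \<tau> [p, q, r]"
      unfolding contains_pattern_def len by blast
  qed
qed

text \<open>The arguments are in order of position. The first conjunct rules out \<open>132\<close>,
  the second \<open>213\<close>; both patterns require \<open>x < z\<close>, which settles many
  triples at once.\<close>

definition free_132_213 :: "'a::linorder \<Rightarrow> 'a \<Rightarrow> 'a \<Rightarrow> bool" where
  "free_132_213 x y z \<longleftrightarrow> \<not> (x < z \<and> z < y) \<and> \<not> (y < x \<and> x < z)"

text \<open>\<open>contains_pattern\<close> only tests \<open><\<close>, so a descent appears there
  as a failed \<open><\<close>. Distinctness turns this into a strict descent.\<close>

lemma avoids_132_213_iff:
  assumes "distinct xs"
  shows "avoids_pattern xs [1, 3, 2] \<and> avoids_pattern xs [2, 1, 3] \<longleftrightarrow>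
    triplewise free_132_213 xs"
proof -
  have "free_132_213 (xs ! i) (xs ! j) (xs ! k) \<longleftrightarrow>
      \<not> (xs ! i < xs ! j \<and> xs ! i < xs ! k \<and> \<not> xs ! j < xs ! k) \<and>
      \<not> (\<not> xs ! i < xs ! j \<and> xs ! i < xs ! k \<and> xs ! j < xs ! k)"
    if "i < j" "j < k" "k < length xs" for i j k
  proof -
    have "xs ! i \<noteq> xs ! j" "xs ! j \<noteq> xs ! k"
      using that assms by (auto simp: nth_eq_iff_index_eq)
    then show ?thesis
      unfolding free_132_213_def by auto
  qed
  then show ?thesis
    unfolding avoids_pattern_def contains_pattern_3 triplewise_iff_nth by simp blast
qed

text \<open>With \<open>m\<close> in front, a descent among larger entries is a \<open>132\<close>,
  and a smaller entry before a larger one is a \<open>213\<close>. No other pair completes a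
  pattern.\<close>

lemma sorted_wrt_free_132_213_iff:
  fixes m :: "'a::linorder"
  assumes "m \<notin> set w"
  shows "sorted_wrt (free_132_213 m) w \<longleftrightarrow>
    w = filter ((<) m) w @ filter (\<lambda>y. y < m) w \<and> sorted (filter ((<) m) w)"
  using assms
proof (induction w)
  case (Cons y w)
  show ?case
  proof (cases "m < y")
    case True
    then show ?thesis
      using Cons by (auto simp: free_132_213_def not_less)
  next
    case False
    then have "y < m"
      using Cons.prems by auto
    \<comment> \<open>The head \<open>y\<close> is below \<open>m\<close>, so it cannot be the first
      of the entries above \<open>m\<close>; that block must be empty.\<close>
    have *: "y # w = filter ((<) m) w @ y # filter (\<lambda>y. y < m) w \<longleftrightarrow> filter ((<) m) w = [] \<and>
        w = filter (\<lambda>y. y < m) w"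
      using \<open>y < m\<close> by (cases "filter ((<) m) w") (auto dest!: filter_eq_ConsD)
    have "(\<forall>z\<in>set w. free_132_213 m y z) \<longleftrightarrow> filter ((<) m) w = []"
      using \<open>y < m\<close> by (auto simp: free_132_213_def filter_empty_conv)
    then show ?thesis
      using Cons \<open>y < m\<close> * by auto
  qed
qed simp

lemma triplewise_free_132_213_if_sorted:
  "sorted xs \<Longrightarrow> triplewise free_132_213 xs"
proof (induction xs)
  case (Cons x xs)
  have "sorted_wrt (free_132_213 x) xs"
  proof (rule sorted_wrt_mono_rel)
    show "sorted xs"
      using Cons.prems by simp
    show "free_132_213 x y z" if "y \<in> set xs" "z \<in> set xs" "y \<le> z" for y z
      using that Cons.prems by (auto simp: free_132_213_def)
  qed
  then show ?case
    using Cons by simp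
qed simp

section \<open>Avoiders and their shape behind a prefix\<close>

definition avoiders :: "nat \<Rightarrow> nat list set" where
  "avoiders n = {\<tau> \<in> permutations_of_set {1..n}. triplewise free_132_213 \<tau>}"

lemma prefix_avoiders_132_213:
  "prefix_avoiders n c {[1, 3, 2], [2, 1, 3]} = {\<tau> \<in> avoiders n. take (length c) \<tau> = c}"
  unfolding prefix_avoiders_def avoiders_def
  by (auto simp: permutations_of_setD avoids_132_213_iff[symmetric])

lemma avoiders_0: "avoiders 0 = {[]}"
  by (auto simp: avoiders_def)

lemma finite_avoiders [simp]: "finite (avoiders n)"
  unfolding avoiders_def by simp

text \<open>The hypotheses \<open>no_between\<close> and \<open>free\<close> are the negations of
  the two obstructions in the theorem. Together they exclude patterns that start in the prefix and
  end among the missing values above \<open>m\<close>.\<close>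

lemma prefix_avoiders_eq_image:
  fixes c :: "nat list" and n :: nat
  defines "R \<equiv> {1..n} - set c" and "m \<equiv> Min (set c)"
  assumes "c \<noteq> []" "distinct c" "set c \<subseteq> {1..n}" "triplewise free_132_213 c"
    and no_between: "\<And>\<alpha> \<beta> x. \<alpha> \<in> R \<Longrightarrow> \<beta> \<in> R \<Longrightarrow> x \<in> set c \<Longrightarrow> \<not> (m < \<alpha> \<and> \<alpha> < x \<and> x < \<beta>)"
    and free: "sorted_wrt (\<lambda>x y. \<forall>z\<in>R. free_132_213 x y z) c"
  shows "{\<tau> \<in> avoiders n. take (length c) \<tau> = c} =
    (\<lambda>w. c @ sorted_list_of_set {x \<in> R. m < x} @ w) ` avoiders (m - 1)"
proof -
  let ?U = "{x \<in> R. m < x}"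
  have m: "m \<in> set c" "\<And>x. x \<in> set c \<Longrightarrow> m \<le> x"
    using \<open>c \<noteq> []\<close> by (auto simp: m_def)
  then have mR: "m \<notin> R" and m1: "1 \<le> m" "m \<le> n"
    using \<open>set c \<subseteq> {1..n}\<close> by (auto simp: R_def)
  \<comment> \<open>By minimality of \<open>m\<close>, the prefix uses no value below it.\<close>
  have L: "{x \<in> R. x < m} = {1..m - 1}"
    unfolding R_def using m(2) m1 by (fastforce simp: not_less[symmetric])
  have "finite R"
    by (simp add: R_def)
  have "\<tau> \<in> (\<lambda>w. c @ sorted_list_of_set ?U @ w) ` avoiders (m - 1)"
    if \<tau>_mem: "\<tau> \<in> avoiders n" and take: "take (length c) \<tau> = c" for \<tau>
  proof -
    have \<tau>: "set \<tau> = {1..n}" "distinct \<tau>" "triplewise free_132_213 \<tau>"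
      using \<tau>_mem by (auto simp: avoiders_def permutations_of_set_def)
    obtain w where \<tau>w: "\<tau> = c @ w"
      using take by (metis append_take_drop_id)
    have w: "set w = R" "distinct w"
      using \<tau>(1,2) unfolding \<tau>w R_def by auto
    have good: "triplewise free_132_213 w" "sorted_wrt (free_132_213 m) w"
      using \<tau>(3) m(1) unfolding \<tau>w triplewise_append by auto
    define u v where "u = filter ((<) m) w" and "v = filter (\<lambda>y. y < m) w"
    have split: "w = u @ v" and "sorted u"
      using good(2) sorted_wrt_free_132_213_iff[of m w] mR w unfolding u_def v_def by blast+
    \<comment> \<open>A sorted list with distinct entries is determined by its set.\<close>
    have "u = sorted_list_of_set ?U"
      using \<open>sorted u\<close> w \<open>finite R\<close> unfolding u_def
      by (intro sorted_distinct_set_unique) auto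
    moreover have "v \<in> avoiders (m - 1)"
    proof -
      have "triplewise free_132_213 v"
        using good(1) unfolding split triplewise_append by blast
      moreover have "set v = {1..m - 1}" "distinct v"
        using w L unfolding v_def by auto
      ultimately show ?thesis
        unfolding avoiders_def permutations_of_set_def by blast
    qed
    ultimately show ?thesis
      unfolding \<tau>w split by blast
  qed
  moreover have "c @ sorted_list_of_set ?U @ w \<in> avoiders n" if "w \<in> avoiders (m - 1)" for w
  proof -
    have w: "set w = {x \<in> R. x < m}" "distinct w" "triplewise free_132_213 w"
      unfolding L using that by (auto simp: avoiders_def permutations_of_set_def)
    define u where "u = sorted_list_of_set ?U"
    have u: "set u = ?U" "distinct u" "sorted u"
      using \<open>finite R\<close> by (auto simp: u_def)
    have uw: "set u \<union> set w = R"
    proof -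
      have "x < m \<or> m < x" if "x \<in> R" for x
        using that mR by (metis neqE)
      then show ?thesis
        unfolding u(1) w(1) by blast
    qed
    have w_lt: "z < m" if "z \<in> set w" for z
      using that w(1) by blast
    have u_gt: "m < z" if "z \<in> set u" for z
      using that u(1) by blast
    have "triplewise free_132_213 u"
      using \<open>sorted u\<close> by (rule triplewise_free_132_213_if_sorted)
    \<comment> \<open>A triple that starts in \<open>u\<close> and ends in \<open>w\<close> has its
      last entry below its first, so it is neither pattern. The same reason serves the next
      step.\<close>
    moreover have "sorted_wrt (free_132_213 x) w" if "x \<in> set u" for x
      using w_lt u_gt[OF that] by (intro sorted_wrtI) (force simp: free_132_213_def)
    moreover have "sorted_wrt (\<lambda>x y. \<forall>z\<in>set w. free_132_213 x y z) u"
      using w_lt u_gt by (intro sorted_wrtI) (force simp: free_132_213_def)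
    ultimately have "triplewise free_132_213 (u @ w)"
      using w(3) by (simp add: triplewise_append)
    moreover have "sorted_wrt (free_132_213 x) (u @ w)" if x: "x \<in> set c" for x
    proof -
      \<comment> \<open>Since \<open>u\<close> increases, no \<open>132\<close> arises. A
        \<open>213\<close> would be \<open>y < x < z\<close> with \<open>m < y\<close>, against
        \<open>no_between\<close>.\<close>
      have "sorted_wrt (free_132_213 x) u"
      proof (rule sorted_wrt_mono_rel[OF _ \<open>sorted u\<close>])
        fix y z assume "y \<in> set u" "z \<in> set u" "y \<le> z"
        then show "free_132_213 x y z"
          using no_between[of y z x] x u(1) by (auto simp: free_132_213_def)
      qed
      moreover have "free_132_213 x y z" if "z \<in> set w" for y z
        using w_lt[OF that] m(2)[OF x] by (auto simp: free_132_213_def)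
      ultimately show ?thesis
        by (auto simp: sorted_wrt_append intro!: sorted_wrtI)
    qed
    \<comment> \<open>Triples with two entries in the prefix are handled by \<open>free\<close>, as
      the third lies in \<open>R\<close>.\<close>
    ultimately have "triplewise free_132_213 (c @ u @ w)"
      using \<open>triplewise free_132_213 c\<close> free uw
      by (simp add: triplewise_append[of _ c])
    moreover have "set (c @ u @ w) = {1..n}"
      using uw \<open>set c \<subseteq> {1..n}\<close> unfolding set_append R_def by blast
    moreover have "distinct (c @ u @ w)"
    proof -
      have "set u \<inter> set w = {}"
        using w_lt u_gt by fastforce
      moreover have "set c \<inter> (set u \<union> set w) = {}"
        unfolding uw R_def by blast
      ultimately show ?thesis
        using \<open>distinct c\<close> u(2) w(2) by auto
    qed
    ultimately show ?thesis
      unfolding u_def avoiders_def permutations_of_set_def by blast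
  qed
  ultimately show ?thesis
    by auto
qed

section \<open>Counting the avoiders\<close>

lemma card_prefix_avoiders:
  fixes c :: "nat list" and n :: nat
  defines "R \<equiv> {1..n} - set c" and "m \<equiv> Min (set c)"
  assumes "c \<noteq> []" "distinct c" "set c \<subseteq> {1..n}" "triplewise free_132_213 c"
    and "\<And>\<alpha> \<beta> x. \<alpha> \<in> R \<Longrightarrow> \<beta> \<in> R \<Longrightarrow> x \<in> set c \<Longrightarrow> \<not> (m < \<alpha> \<and> \<alpha> < x \<and> x < \<beta>)"
    and "sorted_wrt (\<lambda>x y. \<forall>z\<in>R. free_132_213 x y z) c"
  shows "card {\<tau> \<in> avoiders n. take (length c) \<tau> = c} = card (avoiders (m - 1))"
  using assms(3-) unfolding R_def m_def
  by (subst prefix_avoiders_eq_image) (auto simp: card_image inj_on_def)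

text \<open>Avoiders are classified by their first entry \<open>j\<close>. The prefix
  \<open>[j]\<close> has minimum \<open>j\<close>, so its class has as many elements as
  \<open>avoiders (j - 1)\<close>.\<close>

lemma card_avoiders_rec:
  assumes "n > 0"
  shows "card (avoiders n) = (\<Sum>j<n. card (avoiders j))"
proof -
  have "avoiders n = (\<Union>j\<in>{1..n}. {\<tau> \<in> avoiders n. take (length [j]) \<tau> = [j]})"
  proof (intro equalityI subsetI)
    fix \<tau> assume \<tau>: "\<tau> \<in> avoiders n"
    then have "set \<tau> = {1..n}"
      by (auto simp: avoiders_def permutations_of_set_def)
    with assms have "\<tau> \<noteq> []"
      by auto
    with \<open>set \<tau> = {1..n}\<close> have "hd \<tau> \<in> {1..n}"
      by (metis hd_in_set)
    with \<tau> \<open>\<tau> \<noteq> []\<close> show "\<tau> \<in> (\<Union>j\<in>{1..n}. {\<tau> \<in> avoiders n. take (length [j]) \<tau> = [j]})"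
      by (cases \<tau>) auto
  qed auto
  also have "card \<dots> = (\<Sum>j=1..n. card {\<tau> \<in> avoiders n. take (length [j]) \<tau> = [j]})"
    by (intro card_UN_disjoint) auto
  also have "\<dots> = (\<Sum>j=1..n. card (avoiders (j - 1)))"
    by (intro sum.cong refl, subst card_prefix_avoiders) auto
  also have "\<dots> = (\<Sum>j<n. card (avoiders j))"
    by (rule sum.reindex_bij_witness[of _ Suc "\<lambda>j. j - 1"]) auto
  finally show ?thesis .
qed

text \<open>Truncated subtraction gives the value 1 at both \<open>n = 0\<close> and
  \<open>n = 1\<close>. From there on each step doubles the count.\<close>

lemma card_avoiders: "card (avoiders n) = 2 ^ (n - 1)"
proof (induction n rule: less_induct)
  case (less n)
  show ?case
  proof (cases n)
    case 0
    then show ?thesis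
      by (simp add: avoiders_0)
  next
    case (Suc k)
    show ?thesis
    proof (cases k)
      case 0
      then have "card (avoiders n) = card (avoiders 0)"
        using Suc card_avoiders_rec[of n] by simp
      then show ?thesis
        using Suc 0 by (simp add: avoiders_0)
    next
      case (Suc l)
      \<comment> \<open>Split off the last summand of the recursion for \<open>n\<close>; the
        remaining sum is the recursion for \<open>k\<close>, valid as \<open>k > 0\<close>.\<close>
      then have "card (avoiders n) = card (avoiders k) + card (avoiders k)"
        using \<open>n = Suc k\<close> card_avoiders_rec[of n] card_avoiders_rec[of k] by simp
      then show ?thesis
        using less[of k] \<open>n = Suc k\<close> Suc by simp
    qed
  qed
qed

section \<open>The two obstructions and the unobstructed count\<close>

theorem theorem5p6:
  fixes n t :: nat and c :: "nat list"
  assumes "n \<ge> 3" and "1 \<le> t" and "t < n"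
    and "length c = t" and "distinct c" and "set c \<subseteq> {1..n}"
    and "avoids_pattern c [1, 3, 2]" and "avoids_pattern c [2, 1, 3]"
  defines "cond1 \<equiv> \<exists>\<alpha> \<in> {1..n} - set c. \<exists>\<beta> \<in> {1..n} - set c. \<exists>i<t.
      Min (set c) < \<alpha> \<and> \<alpha> < c ! i \<and> c ! i < \<beta>"
    and "cond2 \<equiv> \<exists>\<alpha> \<in> {1..n} - set c. \<exists>i<t. \<exists>j<t. i < j \<and>
      ((c ! i < \<alpha> \<and> \<alpha> < c ! j) \<or> (c ! j < c ! i \<and> c ! i < \<alpha>))"
  shows "(cond1 \<longrightarrow> card (prefix_avoiders n c {[1, 3, 2], [2, 1, 3]}) = 0) \<and>
    (cond2 \<longrightarrow> card (prefix_avoiders n c {[1, 3, 2], [2, 1, 3]}) = 0) \<and>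
    (\<not> cond1 \<and> \<not> cond2 \<longrightarrow>
      card (prefix_avoiders n c {[1, 3, 2], [2, 1, 3]}) = 2 ^ nat (max 0 (int (Min (set c)) - 2)))"
proof -
  let ?T = "{\<tau> \<in> avoiders n. take (length c) \<tau> = c}"
  let ?m = "Min (set c)"
  have ne: "c \<noteq> []" and good: "triplewise free_132_213 c"
    using assms avoids_132_213_iff by auto
  \<comment> \<open>The list \<open>w\<close> is the part of \<tau> after the prefix. The two
    properties kept concern triples with one and with two entries in the prefix, the sources of
    \<open>cond1\<close> and \<open>cond2\<close> respectively.\<close>
  have split: "\<exists>w. set w = {1..n} - set c \<and> (\<forall>x\<in>set c. sorted_wrt (free_132_213 x) w) \<and>
      sorted_wrt (\<lambda>x y. \<forall>z\<in>set w. free_132_213 x y z) c" if "\<tau> \<in> ?T" for \<tau>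
  proof -
    have \<tau>: "set \<tau> = {1..n}" "distinct \<tau>" "triplewise free_132_213 \<tau>" "\<tau> = c @ drop (length c) \<tau>"
      using that append_take_drop_id[of "length c" \<tau>]
      by (auto simp: avoiders_def permutations_of_set_def)
    then have "set c \<union> set (drop (length c) \<tau>) = {1..n}" "set c \<inter> set (drop (length c) \<tau>) = {}"
      by (metis set_append, metis distinct_append)
    then have "set (drop (length c) \<tau>) = {1..n} - set c"
      by blast
    moreover have "triplewise free_132_213 (c @ drop (length c) \<tau>)"
      using \<tau>(3,4) by argo
    ultimately show ?thesis
      unfolding triplewise_append by blast
  qed
  have "?T = {}" if cond1
  proof (rule ccontr)
    assume "?T \<noteq> {}"
    then obtain w where w: "set w = {1..n} - set c" "\<And>x. x \<in> set c \<Longrightarrow> sorted_wrt (free_132_213 x) w"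
      using split by blast
    obtain \<alpha> \<beta> x where *: "\<alpha> \<in> set w" "\<beta> \<in> set w" "x \<in> set c" "?m < \<alpha>" "\<alpha> < x" "x < \<beta>"
      using \<open>cond1\<close> assms(4) w unfolding cond1_def by (metis nth_mem)
    then obtain p q where pq: "p < length w" "q < length w" "w ! p = \<alpha>" "w ! q = \<beta>"
      by (metis in_set_conv_nth)
    then have "p \<noteq> q"
      using * by auto
    have "?m \<in> set c"
      using ne by simp
    then have m: "sorted_wrt (free_132_213 ?m) w" and x: "sorted_wrt (free_132_213 x) w"
      using w * by blast+
    \<comment> \<open>If \<alpha> precedes \<beta> in \<open>w\<close>, then \<open>x\<close>,
      \<alpha>, \<beta> form a \<open>213\<close>. Otherwise \<open>?m\<close>, \<beta>, \<alpha>
      form a \<open>132\<close>.\<close>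
    show False
      using m x * pq \<open>p \<noteq> q\<close> unfolding sorted_wrt_iff_nth_less free_132_213_def
      by (metis linorder_neqE_nat order.strict_trans)
  qed
  \<comment> \<open>The alternatives of \<open>cond2\<close> are a \<open>132\<close> and a
    \<open>213\<close> whose first two entries lie in the prefix and whose last is the missing value
    \<alpha>.\<close>
  moreover have free_iff: "sorted_wrt (\<lambda>x y. \<forall>z\<in>{1..n} - set c. free_132_213 x y z) c \<longleftrightarrow> \<not> cond2"
    using assms(4) unfolding cond2_def sorted_wrt_iff_nth_less free_132_213_def
    by (meson order.strict_trans)
  have "?T = {}" if cond2
  proof (rule ccontr)
    assume "?T \<noteq> {}"
    then show False
      using split free_iff that by fastforce
  qed
  moreover have "card ?T = 2 ^ nat (max 0 (int ?m - 2))" if "\<not> cond1" "\<not> cond2"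
  proof -
    have "card ?T = card (avoiders (?m - 1))"
    proof (rule card_prefix_avoiders)
      show "\<not> (?m < \<alpha> \<and> \<alpha> < x \<and> x < \<beta>)"
        if "\<alpha> \<in> {1..n} - set c" "\<beta> \<in> {1..n} - set c" "x \<in> set c" for \<alpha> \<beta> x
        using that \<open>\<not> cond1\<close> assms(4) unfolding cond1_def by (metis in_set_conv_nth)
    qed (use assms ne good free_iff \<open>\<not> cond2\<close> in blast)+
    \<comment> \<open>One decrement comes from the values below the minimum, the other from the
      exponent in \<open>card_avoiders\<close>. Truncation at 0 matches the maximum, also for
      \<open>?m = 1\<close>.\<close>
    moreover have "nat (max 0 (int ?m - 2)) = ?m - 1 - 1"
      by simp
    ultimately show ?thesis
      by (simp add: card_avoiders)
  qed
  ultimately show ?thesis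
    unfolding prefix_avoiders_132_213 by auto
qed

end
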